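(* Let $k\ge1$ be an integer and let $H$ be a labelled multihypergraph that has a layer-contained certificate $(G,\mathcal T,\ell)$ (for the integer $k$). Then $H$ is $k$-critical and $k$-weakly-partition-connected, and the certified decomposition $\mathcal T$ is the unique ordered $k$-tree decomposition of $G$ having its signature. Hence the certified tree assignment $G$ is $k$-distinguishable.
   Context: A labelled multihypergraph $H=(V,E)$ has a finite vertex set $V$ with $|V|\ge 2$ and a finite set $E=E(H)$ of hyperedge occurrences, each with a support that is a subset of $V$ of cardinality at least $2$ (standing assumptions); distinct occurrences may have the same support and remain distinct. We write $e$ both for the occurrence and its support. For a partition $\mathcal P$ of $V$ let $p_{\mathcal P}(e)$ be the number of blocks of $\mathcal P$ met by $e$, and $w_H(\mathcal P)=\sum_{e\in E}(p_{\mathcal P}(e)-1)$. $H$ is $k$-weakly-partition-connected if $w_H(\mathcal P)\ge k(|\mathcal P|-1)$ for every partition $\mathcal P$ of $V$. With $\rho(H)=\sum_{e\in E}(|e|-1)$, $H$ is $k$-critical if $\rho(H)=k(|V|-1)$. A tree assignment of $H$ chooses, for every $e\in E$, a simple tree $F_e$ with vertex set $e$ and labels every edge of $F_e$ by $e$; the assigned graph is the labelled multigraph $G=\biguplus_{e\in E}F_e$ on $V$ (disjoint union of labelled edge occurrences; parallel edges may arise only from distinct labels). An ordered $k$-tree decomposition of a labelled graph $G$ on $V$ is an ordered partition $E(G)=E(T_0)\,\dot\cup\,\cdots\,\dot\cup\,E(T_{k-1})$ of all edge occurrences in which every $T_i$ is a spanning tree of $V$ (containing no parallel pair). Its signature is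 the vector indexed by $e\in E$ with $\mathrm{sig}_{\mathcal T}(e)=\sum_{i=0}^{k-1} i\,|E(T_i)\cap E(F_e)|$. The assignment $G$ is $k$-distinguishable if it has an ordered $k$-tree decomposition $\mathcal T$ such that every ordered $k$-tree decomposition $\mathcal T'$ of $G$ with $\mathrm{sig}_{\mathcal T'}=\mathrm{sig}_{\mathcal T}$ equals $\mathcal T$. A layer-contained certificate for $H$ (for the integer $k$) consists of a tree assignment $G=\biguplus_{e\in E(H)}F_e$, an ordered $k$-tree decomposition $\mathcal T=(T_0,\ldots,T_{k-1})$ of $G$, and a map $\ell:E(H)\to\{0,\ldots,k-1\}$ such that $E(F_e)\subseteq E(T_{\ell(e)})$ for every hyperedge occurrence $e$. *)

theory Defs
  imports Main "HOL-Library.Disjoint_Sets"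
begin

(* Hyperedge occurrences are arbitrary labels; several of them may share one support. *)
record ('v, 'e) multihypergraph =
  verts :: "'v set"
  occs :: "'e set"
  supp :: "'e \<Rightarrow> 'v set"

definition labelled_multihypergraph :: "('v, 'e) multihypergraph \<Rightarrow> bool" where
  "labelled_multihypergraph H \<longleftrightarrow>
     finite (verts H) \<and> 2 \<le> card (verts H) \<and> finite (occs H) \<and>
     (\<forall>e\<in>occs H. supp H e \<subseteq> verts H \<and> 2 \<le> card (supp H e))"

definition blocks_met :: "'v set set \<Rightarrow> 'v set \<Rightarrow> nat" where
  "blocks_met P S = card {B \<in> P. B \<inter> S \<noteq> {}}"

definition partition_weight :: "('v, 'e) multihypergraph \<Rightarrow> 'v set set \<Rightarrow> int" where
  "partition_weight H P = (\<Sum>e\<in>occs H. int (blocks_met P (supp H e)) - 1)"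

definition weakly_partition_connected :: "nat \<Rightarrow> ('v, 'e) multihypergraph \<Rightarrow> bool" where
  "weakly_partition_connected k H \<longleftrightarrow>
     (\<forall>P. partition_on (verts H) P \<longrightarrow> partition_weight H P \<ge> int k * (int (card P) - 1))"

definition rho :: "('v, 'e) multihypergraph \<Rightarrow> int" where
  "rho H = (\<Sum>e\<in>occs H. int (card (supp H e)) - 1)"

definition critical :: "nat \<Rightarrow> ('v, 'e) multihypergraph \<Rightarrow> bool" where
  "critical k H \<longleftrightarrow> rho H = int k * (int (card (verts H)) - 1)"

definition simple_graph :: "'v set \<Rightarrow> 'v set set \<Rightarrow> bool" where
  "simple_graph S A \<longleftrightarrow> (\<forall>d\<in>A. d \<subseteq> S \<and> card d = 2)"

definition connected_graph :: "'v set \<Rightarrow> 'v set set \<Rightarrow> bool" where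
  "connected_graph S A \<longleftrightarrow>
     S \<noteq> {} \<and> (\<forall>u\<in>S. \<forall>v\<in>S. (u, v) \<in> {(x, y). {x, y} \<in> A}\<^sup>*)"

definition is_cycle :: "'v set set \<Rightarrow> 'v list \<Rightarrow> bool" where
  "is_cycle A c \<longleftrightarrow>
     3 \<le> length c \<and> distinct c \<and>
     (\<forall>i<length c. {c ! i, c ! (Suc i mod length c)} \<in> A)"

(* The tree of the AFP entry Graph_Theory is not the undirected notion: its forest
   only excludes directed cycles. *)
definition simple_tree :: "'v set \<Rightarrow> 'v set set \<Rightarrow> bool" where
  "simple_tree S A \<longleftrightarrow> simple_graph S A \<and> connected_graph S A \<and> (\<nexists>c. is_cycle A c)"

(* An edge occurrence of a labelled multigraph is a pair of its label and its set of ends.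
   Two edges with equal ends and the same label never occur, since every F_e is simple. *)
type_synonym ('v, 'e) labelled_graph = "('e \<times> 'v set) set"

definition tree_assignment :: "('v, 'e) multihypergraph \<Rightarrow> ('e \<Rightarrow> 'v set set) \<Rightarrow> bool" where
  "tree_assignment H F \<longleftrightarrow> (\<forall>e\<in>occs H. simple_tree (supp H e) (F e))"

definition labelled_tree :: "('e \<Rightarrow> 'v set set) \<Rightarrow> 'e \<Rightarrow> ('v, 'e) labelled_graph" where
  "labelled_tree F e = {e} \<times> F e"

definition assigned_graph ::
    "('v, 'e) multihypergraph \<Rightarrow> ('e \<Rightarrow> 'v set set) \<Rightarrow> ('v, 'e) labelled_graph" where
  "assigned_graph H F = (\<Union>e\<in>occs H. labelled_tree F e)"

(* Injectivity of snd says that there is no parallel pair. *)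
definition spanning_tree :: "'v set \<Rightarrow> ('v, 'e) labelled_graph \<Rightarrow> bool" where
  "spanning_tree V T \<longleftrightarrow> inj_on snd T \<and> simple_tree V (snd ` T)"

definition k_tree_decomposition ::
    "nat \<Rightarrow> 'v set \<Rightarrow> ('v, 'e) labelled_graph \<Rightarrow> ('v, 'e) labelled_graph list \<Rightarrow> bool" where
  "k_tree_decomposition k V G Ts \<longleftrightarrow>
     length Ts = k \<and> \<Union>(set Ts) = G \<and>
     (\<forall>i<k. \<forall>j<k. i \<noteq> j \<longrightarrow> Ts ! i \<inter> Ts ! j = {}) \<and>
     (\<forall>i<k. spanning_tree V (Ts ! i))"

definition signature ::
    "('e \<Rightarrow> 'v set set) \<Rightarrow> ('v, 'e) labelled_graph list \<Rightarrow> 'e \<Rightarrow> nat" where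
  "signature F Ts e = (\<Sum>i<length Ts. i * card (Ts ! i \<inter> labelled_tree F e))"

(* Signatures are vectors indexed by the occurrences of H only. *)
definition same_signature ::
    "('v, 'e) multihypergraph \<Rightarrow> ('e \<Rightarrow> 'v set set) \<Rightarrow>
     ('v, 'e) labelled_graph list \<Rightarrow> ('v, 'e) labelled_graph list \<Rightarrow> bool" where
  "same_signature H F Ts Ts' \<longleftrightarrow> (\<forall>e\<in>occs H. signature F Ts e = signature F Ts' e)"

definition k_distinguishable ::
    "nat \<Rightarrow> ('v, 'e) multihypergraph \<Rightarrow> ('e \<Rightarrow> 'v set set) \<Rightarrow> bool" where
  "k_distinguishable k H F \<longleftrightarrow>
     (\<exists>Ts. k_tree_decomposition k (verts H) (assigned_graph H F) Ts \<and>
        (\<forall>Ts'. k_tree_decomposition k (verts H) (assigned_graph H F) Ts' \<and>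
               same_signature H F Ts' Ts \<longrightarrow> Ts' = Ts))"

definition layer_contained_certificate ::
    "nat \<Rightarrow> ('v, 'e) multihypergraph \<Rightarrow> ('e \<Rightarrow> 'v set set) \<Rightarrow>
     ('v, 'e) labelled_graph list \<Rightarrow> ('e \<Rightarrow> nat) \<Rightarrow> bool" where
  "layer_contained_certificate k H F Ts l \<longleftrightarrow>
     tree_assignment H F \<and>
     k_tree_decomposition k (verts H) (assigned_graph H F) Ts \<and>
     (\<forall>e\<in>occs H. l e < k \<and> labelled_tree F e \<subseteq> Ts ! l e)"

end

theory Submission
  imports Defs
begin

text \<open>
  Containment of every \<open>F e\<close> in the single layer \<open>l e\<close> makes the layer \<open>Ts ! i\<close> the disjoint
  union of the trees \<open>F e\<close> with \<open>l e = i\<close>. Everything is read off from this.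

  \<^item> Criticality is a count of edges: a tree on \<open>n\<close> vertices has \<open>n - 1\<close> edges
    (\<open>card_simple_tree\<close>), so the union of the \<open>F e\<close> has \<open>rho H\<close> edges and the union of the
    layers has \<open>k (card V - 1)\<close>.

  \<^item> Partition connectivity holds layer by layer. Since the tree \<open>Ts ! i\<close> connects \<open>V\<close>, so do the
    supports of the hyperedges in layer \<open>i\<close>. Shrinking these supports one after another in the
    quotient of \<open>V\<close> by a partition \<open>P\<close> must reduce the \<open>card P\<close> points to a single one, and
    shrinking a support that meets \<open>p\<close> blocks removes at most \<open>p - 1\<close> points
    (\<open>exists_collapsing_map\<close>). Hence each layer contributes at least \<open>card P - 1\<close> to the partition
    weight, and there are \<open>k\<close> layers.

  \<^item> Uniqueness is by induction on the layers. Suppose that \<open>Ts'\<close> has the signature of \<open>Ts\<close> and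
    agrees with it below \<open>i\<close>. For a hyperedge \<open>e\<close> of layer \<open>i\<close>, every edge of \<open>F e\<close> then lies in
    a layer \<open>j \<ge> i\<close> of \<open>Ts'\<close>, whereas the signature says that the average of these indices
    is \<open>i\<close>; so all of them are \<open>i\<close>. Thus \<open>Ts ! i \<subseteq> Ts' ! i\<close>, and both are spanning trees of
    the same size.
\<close>

section \<open>Collapsing a connected hypergraph\<close>

text \<open>
  The map \<open>h\<close> glues together, for every \<open>e\<close>, all colours that \<open>f\<close> uses on \<open>X e\<close>. Gluing \<open>p\<close>
  colours into one loses \<open>p - 1\<close> of them, and earlier gluings only lower this loss.
\<close>

lemma exists_collapsing_map:
  fixes f :: "'v \<Rightarrow> 'c"
  assumes "finite E" and V: "finite V" and "\<forall>e\<in>E. X e \<subseteq> V"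
  shows "\<exists>h :: 'c \<Rightarrow> 'c. (\<forall>e\<in>E. \<forall>x\<in>X e. \<forall>y\<in>X e. h (f x) = h (f y)) \<and>
           card (f ` V) \<le> card (h ` f ` V) + (\<Sum>e\<in>E. card (f ` X e) - 1)"
  using assms(1,3)
proof (induction E rule: finite_induct)
  case empty
  show ?case by (intro exI[of _ id]) simp
next
  case (insert e E)
  have "\<forall>e\<in>E. X e \<subseteq> V" using insert.prems by simp
  from insert.IH[OF this] obtain h :: "'c \<Rightarrow> 'c" where h: "\<forall>e\<in>E. \<forall>x\<in>X e. \<forall>y\<in>X e. h (f x) = h (f y)"
      "card (f ` V) \<le> card (h ` f ` V) + (\<Sum>e\<in>E. card (f ` X e) - 1)"
    by blast
  show ?case
  proof (cases "X e = {}")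
    case True
    then have "(\<Sum>e\<in>insert e E. card (f ` X e) - 1) = (\<Sum>e\<in>E. card (f ` X e) - 1)"
      using insert.hyps by simp
    moreover have "\<forall>e'\<in>insert e E. \<forall>x\<in>X e'. \<forall>y\<in>X e'. h (f x) = h (f y)"
      using h(1) True by blast
    ultimately show ?thesis using h(2) by (metis (no_types))
  next
    case False
    then obtain x0 where x0: "x0 \<in> X e" by blast
    have Xe: "X e \<subseteq> V" using insert.prems by simp
    define C where "C = h ` f ` X e"
    define h' where "h' = (\<lambda>z. if h z \<in> C then h (f x0) else h z)"
    have x0V: "x0 \<in> V" and x0C: "h (f x0) \<in> C"
      using x0 Xe by (auto simp: C_def)
    have "insert (h (f x0)) (h ` f ` V - C) \<subseteq> h' ` f ` V"
    proof
      fix y assume y: "y \<in> insert (h (f x0)) (h ` f ` V - C)"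
      show "y \<in> h' ` f ` V"
      proof (cases "y = h (f x0)")
        case True
        then have "y = h' (f x0)" using x0C by (simp add: h'_def)
        then show ?thesis using x0V by blast
      next
        case False
        then obtain x where x: "x \<in> V" "y = h (f x)" "h (f x) \<notin> C" using y by auto
        then have "y = h' (f x)" by (simp add: h'_def)
        then show ?thesis using x by blast
      qed
    qed
    then have "card (insert (h (f x0)) (h ` f ` V - C)) \<le> card (h' ` f ` V)"
      using V by (intro card_mono) auto
    moreover have "card (insert (h (f x0)) (h ` f ` V - C)) = Suc (card (h ` f ` V - C))"
      using V x0C by (subst card_insert_disjoint) auto
    moreover have "(h ` f ` V - C) \<union> C = h ` f ` V"
      using Xe by (auto simp: C_def)
    then have "card (h ` f ` V) \<le> card (h ` f ` V - C) + card C"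
      by (metis card_Un_le)
    moreover have "card C \<le> card (f ` X e)"
      unfolding C_def using V Xe by (intro card_image_le) (auto intro: finite_subset)
    ultimately have "card (f ` V) \<le> card (h' ` f ` V) + (\<Sum>e\<in>insert e E. card (f ` X e) - 1)"
      using h(2) unfolding sum.insert[OF insert.hyps] by linarith
    moreover have "\<forall>e'\<in>insert e E. \<forall>x\<in>X e'. \<forall>y\<in>X e'. h' (f x) = h' (f y)"
    proof (intro ballI)
      fix e' x y assume "e' \<in> insert e E" "x \<in> X e'" "y \<in> X e'"
      then consider "h (f x) = h (f y)" | "h (f x) \<in> C" "h (f y) \<in> C"
        using h(1) unfolding C_def by blast
      then show "h' (f x) = h' (f y)" by cases (simp_all add: h'_def)
    qed
    ultimately show ?thesis by blast
  qed
qed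

text \<open>
  Connectivity enters as the statement that a map which is constant on every \<open>X e\<close> is constant
  on \<open>V\<close>: a collapsing map then leaves one colour only.
\<close>

lemma card_image_le_sum_if_connected:
  fixes f :: "'v \<Rightarrow> 'c"
  assumes "finite E" "finite V" "\<And>e. e \<in> E \<Longrightarrow> X e \<subseteq> V"
    and conn: "\<And>g :: 'v \<Rightarrow> 'c. (\<forall>e\<in>E. \<forall>x\<in>X e. \<forall>y\<in>X e. g x = g y) \<Longrightarrow>
                 (\<forall>x\<in>V. \<forall>y\<in>V. g x = g y)"
  shows "card (f ` V) \<le> 1 + (\<Sum>e\<in>E. card (f ` X e) - 1)"
proof -
  obtain h :: "'c \<Rightarrow> 'c" where h: "\<forall>e\<in>E. \<forall>x\<in>X e. \<forall>y\<in>X e. h (f x) = h (f y)"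
      "card (f ` V) \<le> card (h ` f ` V) + (\<Sum>e\<in>E. card (f ` X e) - 1)"
    using exists_collapsing_map[OF assms(1,2), of X f] assms(3) by blast
  have "\<forall>x\<in>V. \<forall>y\<in>V. h (f x) = h (f y)"
    using conn[of "\<lambda>x. h (f x)"] h(1) by blast
  moreover have "finite (h ` f ` V)" using assms(2) by simp
  ultimately have "card (h ` f ` V) \<le> Suc 0"
    unfolding card_le_Suc0_iff_eq[OF \<open>finite (h ` f ` V)\<close>] by blast
  then show ?thesis using h(2) by simp
qed

lemma constant_if_connected_graph:
  assumes "connected_graph S A" "\<forall>d\<in>A. \<forall>x\<in>d. \<forall>y\<in>d. g x = g y" "x \<in> S" "y \<in> S"
  shows "g x = g y"
proof -
  have "(x, y) \<in> {(x, y). {x, y} \<in> A}\<^sup>*"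
    using assms unfolding connected_graph_def by blast
  then show ?thesis
    by (induction rule: rtrancl_induct) (use assms(2) in auto)
qed

section \<open>The number of edges of a tree\<close>

lemma finite_simple_graph:
  assumes "finite S" "simple_graph S A"
  shows "finite A"
  using assms unfolding simple_graph_def by (intro finite_subset[of A "Pow S"]) auto

text \<open>
  Collapsing along an edge removes at most one vertex, so a connected graph needs at least
  \<open>card S - 1\<close> edges.
\<close>

lemma card_le_if_connected_graph:
  assumes "finite S" "simple_graph S A" "connected_graph S A"
  shows "card S \<le> 1 + card A"
proof -
  have "card (id ` S) \<le> 1 + (\<Sum>d\<in>A. card (id ` d) - 1)"
  proof (rule card_image_le_sum_if_connected)
    show "finite A" using assms(1,2) by (rule finite_simple_graph)
    show "d \<subseteq> S" if "d \<in> A" for d using assms(2) that by (simp add: simple_graph_def)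
    show "\<forall>x\<in>S. \<forall>y\<in>S. g x = g y" if "\<forall>d\<in>A. \<forall>x\<in>d. \<forall>y\<in>d. g x = g y" for g :: "'a \<Rightarrow> 'a"
      using constant_if_connected_graph[OF assms(3) that] by blast
  qed (rule assms(1))
  also have "(\<Sum>d\<in>A. card (id ` d) - 1) = card A"
    using assms(2) by (simp add: simple_graph_def)
  finally show ?thesis by simp
qed

lemma exists_distinct_path:
  assumes "(u, v) \<in> r\<^sup>*"
  shows "\<exists>p. p \<noteq> [] \<and> p ! 0 = u \<and> p ! (length p - 1) = v \<and> distinct p \<and>
           (\<forall>i. Suc i < length p \<longrightarrow> (p ! i, p ! Suc i) \<in> r)"
  using assms
proof (induction rule: rtrancl_induct)
  case base
  show ?case by (intro exI[of _ "[u]"]) simp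
next
  case (step y z)
  then obtain p where p: "p \<noteq> []" "p ! 0 = u" "p ! (length p - 1) = y" "distinct p"
      "\<forall>i. Suc i < length p \<longrightarrow> (p ! i, p ! Suc i) \<in> r" by blast
  show ?case
  proof (cases "z \<in> set p")
    case True
    \<comment> \<open>The path already visits \<open>z\<close>, so it is cut off there.\<close>
    then obtain n where n: "n < length p" "p ! n = z" by (auto simp: in_set_conv_nth)
    then have "length (take (Suc n) p) = Suc n" by simp
    then show ?thesis using p n
      by (intro exI[of _ "take (Suc n) p"]) (simp del: length_take)
  next
    case False
    have "((p @ [z]) ! i, (p @ [z]) ! Suc i) \<in> r" if "Suc i < length (p @ [z])" for i
    proof (cases "Suc i < length p")
      case True
      then show ?thesis using p(5) by (simp add: nth_append)
    next
      case False
      then have "i = length p - 1" "Suc i = length p" using that by auto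
      then show ?thesis using p(3) step.hyps(2) by (simp add: nth_append)
    qed
    then show ?thesis using p False
      by (intro exI[of _ "p @ [z]"]) (auto simp: nth_append)
  qed
qed

text \<open>
  An edge between two vertices that are already connected closes a cycle; the cycle has length at
  least three because the edge is new and not a loop.
\<close>

lemma exists_cycle_insert:
  assumes "(u, v) \<in> {(x, y). {x, y} \<in> A}\<^sup>*" "{u, v} \<notin> A" "u \<noteq> v"
  shows "\<exists>c. is_cycle (insert {u, v} A) c"
proof -
  obtain p where p: "p \<noteq> []" "p ! 0 = u" "p ! (length p - 1) = v" "distinct p"
      and steps: "\<And>i. Suc i < length p \<Longrightarrow> {p ! i, p ! Suc i} \<in> A"
    using exists_distinct_path[OF assms(1)] by auto
  have "length p \<noteq> 0" using p by simp
  moreover have "length p \<noteq> 1" using p assms(3) by auto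
  moreover have "length p \<noteq> 2" using p steps[of 0] assms(2) by auto
  ultimately have len: "3 \<le> length p" by linarith
  have "{p ! i, p ! (Suc i mod length p)} \<in> insert {u, v} A" if "i < length p" for i
  proof (cases "Suc i < length p")
    case True
    then show ?thesis using steps by simp
  next
    case False
    then have "i = length p - 1" "Suc i = length p" using that by auto
    then show ?thesis using p by (simp add: insert_commute)
  qed
  then have "is_cycle (insert {u, v} A) p"
    using p(4) len unfolding is_cycle_def by blast
  then show ?thesis ..
qed

text \<open>
  The colours of \<open>g\<close> name the components: each new edge of an acyclic graph joins two of them.
\<close>

lemma exists_component_colouring:
  fixes S :: "'v set"
  assumes "finite A" "finite S" "simple_graph S A" "\<nexists>c. is_cycle A c"
  shows "\<exists>g :: 'v \<Rightarrow> 'v. card A + card (g ` S) = card S \<and>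
           (\<forall>x\<in>S. \<forall>y\<in>S. g x = g y \<longrightarrow> (x, y) \<in> {(x, y). {x, y} \<in> A}\<^sup>*)"
  using assms(1,3,4)
proof (induction A rule: finite_induct)
  case empty
  show ?case by (intro exI[of _ id]) auto
next
  case (insert d A)
  let ?R = "\<lambda>A. {(x, y). {x, y} \<in> A}\<^sup>*"
  have mono: "?R A \<subseteq> ?R (insert d A)" by (intro rtrancl_mono) auto
  have sym: "(y, x) \<in> ?R B" if "(x, y) \<in> ?R B" for x y :: 'v and B
  proof -
    have "sym (?R B)" by (intro sym_rtrancl) (auto simp: sym_def insert_commute)
    then show ?thesis using that by (rule symD)
  qed
  have "\<nexists>c. is_cycle A c" using insert.prems(2) unfolding is_cycle_def by blast
  moreover have "simple_graph S A" using insert.prems(1) by (simp add: simple_graph_def)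
  ultimately obtain g :: "'v \<Rightarrow> 'v" where g: "card A + card (g ` S) = card S"
      "\<forall>x\<in>S. \<forall>y\<in>S. g x = g y \<longrightarrow> (x, y) \<in> ?R A"
    using insert.IH by blast
  have "card d = 2" "d \<subseteq> S" using insert.prems(1) by (auto simp: simple_graph_def)
  then obtain u v where d: "d = {u, v}" "u \<noteq> v" and uv: "u \<in> S" "v \<in> S"
    by (auto simp: card_2_iff)
  have "(u, v) \<notin> ?R A"
    using exists_cycle_insert[of u v A] insert.hyps(2) insert.prems(2) d by blast
  then have guv: "g u \<noteq> g v" using g(2) uv by blast
  define g' where "g' = (\<lambda>x. if g x = g v then g u else g x)"
  have "g' ` S = g ` S - {g v}"
    using uv guv by (auto simp: g'_def)
  then have "card (g' ` S) = card (g ` S) - 1"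
    using uv assms(2) by simp
  moreover have "0 < card (g ` S)" using uv assms(2) by (auto simp: card_gt_0_iff)
  ultimately have "card (insert d A) + card (g' ` S) = card S"
    using g(1) insert.hyps by simp
  moreover have "(x, y) \<in> ?R (insert d A)"
    if xy: "x \<in> S" "y \<in> S" "g' x = g' y" for x y
  proof -
    have same: "(a, b) \<in> ?R (insert d A)" if "a \<in> S" "b \<in> S" "g a = g b" for a b
      using g(2) that mono by blast
    have uv': "(u, v) \<in> ?R (insert d A)" using d by (intro r_into_rtrancl) auto
    \<comment> \<open>Recolouring the class of \<open>v\<close> is harmless: it can be left through the edge from \<open>v\<close> to \<open>u\<close>.\<close>
    have to: "(a, b) \<in> ?R (insert d A)" if "a \<in> S" "b \<in> S" "g a = g v" "g b = g u" for a b
      using rtrancl_trans[OF rtrancl_trans[OF same[of a v] sym[OF uv']] same[of u b]] that uv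
      by simp
    consider "g x = g y" | "g x = g v" "g y = g u" | "g x = g u" "g y = g v"
      using xy(3) by (auto simp: g'_def split: if_splits)
    then show ?thesis
      using same[of x y] to[of x y] sym[OF to[of y x]] xy by cases auto
  qed
  ultimately show ?case by blast
qed

lemma card_simple_tree:
  assumes "finite S" "simple_tree S A"
  shows "Suc (card A) = card S"
proof -
  have A: "simple_graph S A" "connected_graph S A" "\<nexists>c. is_cycle A c"
    using assms(2) by (auto simp: simple_tree_def)
  have "S \<noteq> {}" using A(2) by (simp add: connected_graph_def)
  obtain g :: "'a \<Rightarrow> 'a" where "card A + card (g ` S) = card S"
    using exists_component_colouring[OF finite_simple_graph assms(1)] A assms(1) by blast
  moreover have "0 < card (g ` S)" using \<open>S \<noteq> {}\<close> assms(1) by (auto simp: card_gt_0_iff)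
  ultimately show ?thesis
    using card_le_if_connected_graph[OF assms(1) A(1,2)] by linarith
qed

lemma card_spanning_tree:
  assumes "finite V" "spanning_tree V T"
  shows "finite T" "Suc (card T) = card V"
proof -
  have T: "inj_on snd T" "simple_tree V (snd ` T)"
    using assms(2) by (auto simp: spanning_tree_def)
  show "finite T"
    using T finite_simple_graph[OF assms(1)] by (auto simp: simple_tree_def dest: finite_imageD)
  show "Suc (card T) = card V"
    using card_simple_tree[OF assms(1) T(2)] T(1) by (simp add: card_image)
qed

section \<open>Partition weights\<close>

lemma blocks_met_eq_card_image:
  assumes "partition_on V P"
  obtains f where "f ` V = P" "\<And>S. S \<subseteq> V \<Longrightarrow> blocks_met P S = card (f ` S)"
proof -
  have "\<forall>x\<in>V. \<exists>B. B \<in> P \<and> x \<in> B" using assms by (auto simp: partition_on_def)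
  then obtain f where f: "\<And>x. x \<in> V \<Longrightarrow> f x \<in> P \<and> x \<in> f x" by metis
  have unique: "f x = B" if "B \<in> P" "x \<in> B" for x B
  proof -
    have "x \<in> V" using that assms by (auto simp: partition_on_def)
    then show ?thesis using f[of x] that assms by (auto simp: partition_on_def disjoint_def)
  qed
  have met: "{B \<in> P. B \<inter> S \<noteq> {}} = f ` S" if S: "S \<subseteq> V" for S
  proof (intro equalityI subsetI)
    fix B assume "B \<in> {B \<in> P. B \<inter> S \<noteq> {}}"
    then obtain x where "B \<in> P" "x \<in> B" "x \<in> S" by blast
    then show "B \<in> f ` S" using unique by blast
  next
    fix B assume "B \<in> f ` S"
    then show "B \<in> {B \<in> P. B \<inter> S \<noteq> {}}" using f S by blast
  qed
  have all_met: "{B \<in> P. B \<inter> V \<noteq> {}} = P"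
  proof -
    have "B \<inter> V \<noteq> {}" if "B \<in> P" for B
    proof -
      have "B \<subseteq> V" "B \<noteq> {}" using that assms by (auto simp: partition_on_def)
      then show ?thesis by blast
    qed
    then show ?thesis by blast
  qed
  show thesis
  proof (rule that)
    show "f ` V = P" using met[of V] all_met by simp
    show "blocks_met P S = card (f ` S)" if "S \<subseteq> V" for S
      unfolding blocks_met_def met[OF that] ..
  qed
qed

text \<open>
  Connectivity of \<open>V\<close> is used for maps into blocks: the points being collapsed are the blocks
  of \<open>P\<close>.
\<close>

lemma card_partition_le_if_connected:
  assumes "finite E" "finite V" "\<And>e. e \<in> E \<Longrightarrow> X e \<subseteq> V \<and> X e \<noteq> {}"
    and conn: "\<And>g :: 'v \<Rightarrow> 'v set. (\<forall>e\<in>E. \<forall>x\<in>X e. \<forall>y\<in>X e. g x = g y) \<Longrightarrow>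
                 (\<forall>x\<in>V. \<forall>y\<in>V. g x = g y)"
    and "partition_on V P"
  shows "int (card P) - 1 \<le> (\<Sum>e\<in>E. int (blocks_met P (X e)) - 1)"
proof -
  obtain f where f: "f ` V = P" "\<And>S. S \<subseteq> V \<Longrightarrow> blocks_met P S = card (f ` S)"
    by (rule blocks_met_eq_card_image[OF assms(5)]) (rule that)
  define s where "s = (\<Sum>e\<in>E. card (f ` X e) - 1)"
  have "card (f ` V) \<le> 1 + s"
    unfolding s_def
    by (rule card_image_le_sum_if_connected[OF assms(1,2) _ conn]) (simp add: assms(3))
  then have "int (card P) - 1 \<le> int s"
    unfolding f(1) by linarith
  also have "\<dots> = (\<Sum>e\<in>E. int (blocks_met P (X e)) - 1)"
    unfolding s_def of_nat_sum
  proof (intro sum.cong refl)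
    fix e assume e: "e \<in> E"
    then have "finite (X e)" "X e \<noteq> {}"
      using assms(3) finite_subset[OF _ assms(2)] by auto
    then have "0 < card (f ` X e)" by (simp add: card_gt_0_iff)
    then show "int (card (f ` X e) - 1) = int (blocks_met P (X e)) - 1"
      using f(2) assms(3)[OF e] by simp
  qed
  finally show ?thesis .
qed

section \<open>Layer-contained certificates\<close>

lemma decomposition_layer_unique:
  assumes "k_tree_decomposition k V G Ts" "i < k" "j < k" "x \<in> Ts ! i" "x \<in> Ts ! j"
  shows "i = j"
proof (rule ccontr)
  assume "i \<noteq> j"
  then have "Ts ! i \<inter> Ts ! j = {}" using assms(1-3) by (simp add: k_tree_decomposition_def)
  then show False using assms(4,5) by blast
qed

lemma decomposition_eq_Union_layers:
  assumes "k_tree_decomposition k V G Ts"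
  shows "G = (\<Union>j<k. Ts ! j)"
proof -
  have "set Ts = (!) Ts ` {..<k}"
    using assms by (auto simp: k_tree_decomposition_def in_set_conv_nth)
  then show ?thesis using assms by (simp add: k_tree_decomposition_def)
qed

text \<open>
  A family of indices that are all at least \<open>i\<close> and have average \<open>i\<close> is constant; \<open>a j\<close> is the
  number of times that the index \<open>j\<close> occurs.
\<close>

lemma concentrated_if_weighted_sum_eq:
  fixes a :: "nat \<Rightarrow> nat"
  assumes "(\<Sum>j<k. j * a j) = i * (\<Sum>j<k. a j)" "\<And>j. j < i \<Longrightarrow> a j = 0"
    and "j < k" "j \<noteq> i"
  shows "a j = 0"
proof -
  have "(\<Sum>j<k. j * a j) = (\<Sum>j<k. i * a j + (j - i) * a j)"
  proof (intro sum.cong refl)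
    fix j show "j * a j = i * a j + (j - i) * a j"
      using assms(2)[of j] by (cases "j < i") (auto simp flip: add_mult_distrib)
  qed
  then have "(\<Sum>j<k. (j - i) * a j) = 0"
    using assms(1) by (simp add: sum.distrib sum_distrib_left)
  then have "(j - i) * a j = 0" using assms(3) by simp
  then show ?thesis using assms(2)[of j] assms(4) by (cases "j < i") auto
qed

context
  fixes k :: nat
    and H :: "('v, 'e) multihypergraph"
    and F :: "'e \<Rightarrow> 'v set set"
    and Ts :: "('v, 'e) labelled_graph list"
    and l :: "'e \<Rightarrow> nat"
  assumes hypergraph: "labelled_multihypergraph H"
    and certificate: "layer_contained_certificate k H F Ts l"
begin

lemma finite_verts: "finite (verts H)" and finite_occs: "finite (occs H)"
  using hypergraph by (auto simp: labelled_multihypergraph_def)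

lemma supp_props:
  assumes "e \<in> occs H"
  shows "supp H e \<subseteq> verts H" "finite (supp H e)" "supp H e \<noteq> {}"
proof -
  have "supp H e \<subseteq> verts H \<and> 2 \<le> card (supp H e)"
    using hypergraph assms by (simp add: labelled_multihypergraph_def)
  then show "supp H e \<subseteq> verts H" "finite (supp H e)" "supp H e \<noteq> {}"
    using finite_subset[OF _ finite_verts] by auto
qed

lemma simple_tree_F: "e \<in> occs H \<Longrightarrow> simple_tree (supp H e) (F e)"
  using certificate by (simp add: layer_contained_certificate_def tree_assignment_def)

lemma finite_labelled_tree:
  assumes "e \<in> occs H"
  shows "finite (labelled_tree F e)"
  using simple_tree_F[OF assms] finite_simple_graph[OF supp_props(2)[OF assms]]
  by (simp add: labelled_tree_def simple_tree_def)

lemma card_labelled_tree: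
  assumes "e \<in> occs H"
  shows "Suc (card (labelled_tree F e)) = card (supp H e)"
  using card_simple_tree[OF supp_props(2) simple_tree_F] assms
  by (simp add: labelled_tree_def card_cartesian_product_singleton)

lemma certificate_decomposition: "k_tree_decomposition k (verts H) (assigned_graph H F) Ts"
  using certificate by (simp add: layer_contained_certificate_def)

lemma certificate_layer: "e \<in> occs H \<Longrightarrow> l e < k" "e \<in> occs H \<Longrightarrow> labelled_tree F e \<subseteq> Ts ! l e"
  using certificate by (auto simp: layer_contained_certificate_def)

text \<open>
  The certificate only gives the inclusion from right to left. Equality holds because the layers
  are disjoint and the trees \<open>F e\<close> exhaust the graph.
\<close>

lemma layer_eq_Union:
  assumes "i < k"
  shows "Ts ! i = (\<Union>e\<in>{e \<in> occs H. l e = i}. labelled_tree F e)"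
proof (intro equalityI subsetI)
  fix x assume x: "x \<in> Ts ! i"
  then have "x \<in> assigned_graph H F"
    using decomposition_eq_Union_layers[OF certificate_decomposition] assms by blast
  then obtain e where e: "e \<in> occs H" "x \<in> labelled_tree F e"
    by (auto simp: assigned_graph_def)
  then have "x \<in> Ts ! l e" "l e < k" using certificate_layer by auto
  then have "l e = i"
    using decomposition_layer_unique[OF certificate_decomposition] x assms by blast
  then show "x \<in> (\<Union>e\<in>{e \<in> occs H. l e = i}. labelled_tree F e)" using e by blast
next
  fix x assume "x \<in> (\<Union>e\<in>{e \<in> occs H. l e = i}. labelled_tree F e)"
  then show "x \<in> Ts ! i" using certificate_layer(2) by blast
qed

lemma sum_over_layers: "(\<Sum>e\<in>occs H. f e) = (\<Sum>i<k. \<Sum>e\<in>{e \<in> occs H. l e = i}. f e)"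
  using finite_occs certificate_layer(1) by (intro sum.group[symmetric]) auto

lemma certificate_critical: "critical k H"
proof -
  have "(\<Sum>e\<in>{e \<in> occs H. l e = i}. int (card (supp H e)) - 1) = int (card (verts H)) - 1"
    if i: "i < k" for i
  proof -
    have "spanning_tree (verts H) (Ts ! i)"
      using certificate_decomposition i by (simp add: k_tree_decomposition_def)
    then have "Suc (card (Ts ! i)) = card (verts H)"
      using card_spanning_tree finite_verts by blast
    moreover have "card (Ts ! i) = (\<Sum>e\<in>{e \<in> occs H. l e = i}. card (labelled_tree F e))"
      unfolding layer_eq_Union[OF i] using finite_occs finite_labelled_tree
      by (intro card_UN_disjoint) (auto simp: labelled_tree_def)
    moreover have "(\<Sum>e\<in>{e \<in> occs H. l e = i}. int (card (supp H e)) - 1) =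
        (\<Sum>e\<in>{e \<in> occs H. l e = i}. int (card (labelled_tree F e)))"
      using card_labelled_tree by (intro sum.cong refl) (force simp flip: card_labelled_tree)
    ultimately show ?thesis by (simp only: flip: of_nat_sum)
  qed
  then show ?thesis
    unfolding critical_def rho_def by (subst sum_over_layers) simp
qed

lemma layer_connected:
  assumes "i < k" "\<forall>e\<in>{e \<in> occs H. l e = i}. \<forall>x\<in>supp H e. \<forall>y\<in>supp H e. g x = g y"
  shows "\<forall>x\<in>verts H. \<forall>y\<in>verts H. g x = g y"
proof -
  have "connected_graph (verts H) (snd ` (Ts ! i))"
    using certificate_decomposition assms(1)
    by (simp add: k_tree_decomposition_def spanning_tree_def simple_tree_def)
  moreover have "\<forall>d\<in>snd ` (Ts ! i). \<forall>x\<in>d. \<forall>y\<in>d. g x = g y"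
  proof
    fix d assume "d \<in> snd ` (Ts ! i)"
    then obtain e where e: "e \<in> occs H" "l e = i" "d \<in> F e"
      unfolding layer_eq_Union[OF assms(1)] by (auto simp: labelled_tree_def)
    then have "d \<subseteq> supp H e"
      using simple_tree_F[of e] by (auto simp: simple_tree_def simple_graph_def)
    then show "\<forall>x\<in>d. \<forall>y\<in>d. g x = g y" using assms(2) e by blast
  qed
  ultimately show ?thesis by (intro ballI) (rule constant_if_connected_graph)
qed

lemma certificate_weakly_partition_connected: "weakly_partition_connected k H"
  unfolding weakly_partition_connected_def
proof (intro allI impI)
  fix P assume P: "partition_on (verts H) P"
  have "int (card P) - 1 \<le> (\<Sum>e\<in>{e \<in> occs H. l e = i}. int (blocks_met P (supp H e)) - 1)"
    if "i < k" for i
  proof (rule card_partition_le_if_connected[OF _ finite_verts _ layer_connected[OF that] P])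
    show "finite {e \<in> occs H. l e = i}" using finite_occs by simp
    show "supp H e \<subseteq> verts H \<and> supp H e \<noteq> {}" if "e \<in> {e \<in> occs H. l e = i}" for e
      using supp_props[of e] that by simp
  qed
  then have "(\<Sum>i<k. int (card P) - 1) \<le> partition_weight H P"
    unfolding partition_weight_def
    by (subst sum_over_layers) (intro sum_mono, simp)
  then show "int k * (int (card P) - 1) \<le> partition_weight H P" by simp
qed

lemma signature_certificate:
  assumes e: "e \<in> occs H"
  shows "signature F Ts e = l e * card (labelled_tree F e)"
proof -
  have disj: "Ts ! j \<inter> labelled_tree F e = {}" if "j < k" "j \<noteq> l e" for j
    using decomposition_layer_unique[OF certificate_decomposition, of j "l e"] certificate_layer[OF e] that by auto
  have "signature F Ts e = (\<Sum>j<k. if j = l e then l e * card (labelled_tree F e) else 0)"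
    unfolding signature_def using certificate_decomposition disj certificate_layer(2)[OF e]
    by (intro sum.cong) (auto simp: k_tree_decomposition_def Int_absorb1)
  then show ?thesis using certificate_layer(1)[OF e] by simp
qed

text \<open>
  Below layer \<open>l e\<close> the two decompositions coincide, so no edge of \<open>F e\<close> can lie there in
  \<open>Ts'\<close>; an edge of \<open>F e\<close> above layer \<open>l e\<close> would make the signature too large.
\<close>

lemma labelled_tree_subset_layer:
  assumes Ts': "k_tree_decomposition k (verts H) (assigned_graph H F) Ts'"
    and sig: "signature F Ts' e = signature F Ts e"
    and e: "e \<in> occs H"
    and below: "\<And>j. j < l e \<Longrightarrow> Ts' ! j = Ts ! j"
  shows "labelled_tree F e \<subseteq> Ts' ! l e"
proof -
  let ?L = "labelled_tree F e"
  have "?L \<subseteq> assigned_graph H F" using e by (auto simp: assigned_graph_def)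
  then have L: "?L = (\<Union>j<k. Ts' ! j \<inter> ?L)"
    unfolding decomposition_eq_Union_layers[OF Ts'] by blast
  have "card ?L = card (\<Union>j<k. Ts' ! j \<inter> ?L)" using L by simp
  also have "\<dots> = (\<Sum>j<k. card (Ts' ! j \<inter> ?L))"
    using decomposition_layer_unique[OF Ts'] finite_labelled_tree[OF e]
    by (intro card_UN_disjoint) auto
  finally have "(\<Sum>j<k. j * card (Ts' ! j \<inter> ?L)) = l e * (\<Sum>j<k. card (Ts' ! j \<inter> ?L))"
    using sig signature_certificate[OF e] Ts' by (simp add: signature_def k_tree_decomposition_def)
  moreover have "card (Ts' ! j \<inter> ?L) = 0" if "j < l e" for j
  proof -
    have "Ts ! j \<inter> ?L = {}"
      using decomposition_layer_unique[OF certificate_decomposition, of j "l e"] certificate_layer[OF e] that by auto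
    then show ?thesis using below[OF that] by simp
  qed
  ultimately have zero: "card (Ts' ! j \<inter> ?L) = 0" if "j < k" "j \<noteq> l e" for j
    using concentrated_if_weighted_sum_eq[where a = "\<lambda>j. card (Ts' ! j \<inter> ?L)" and i = "l e"] that by blast
  have empty: "Ts' ! j \<inter> ?L = {}" if "j < k" "j \<noteq> l e" for j
    using zero[OF that] finite_labelled_tree[OF e] by simp
  show ?thesis
  proof
    fix x assume "x \<in> ?L"
    then obtain j where "j < k" "x \<in> Ts' ! j \<inter> ?L" using L by blast
    then show "x \<in> Ts' ! l e" using empty[of j] by (cases "j = l e") auto
  qed
qed

lemma certificate_unique:
  assumes Ts': "k_tree_decomposition k (verts H) (assigned_graph H F) Ts'"
    and sig: "same_signature H F Ts' Ts"
  shows "Ts' = Ts"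
proof (rule nth_equalityI)
  show "length Ts' = length Ts"
    using Ts' certificate_decomposition by (simp add: k_tree_decomposition_def)
  have "Ts' ! i = Ts ! i" if "i < k" for i
    using that
  proof (induction i rule: less_induct)
    case (less i)
    have "labelled_tree F e \<subseteq> Ts' ! i" if "e \<in> occs H" "l e = i" for e
      using labelled_tree_subset_layer[OF Ts'] sig less that
      by (auto simp: same_signature_def)
    then have "Ts ! i \<subseteq> Ts' ! i"
      unfolding layer_eq_Union[OF \<open>i < k\<close>] by blast
    moreover have "spanning_tree (verts H) (Ts ! i)" "spanning_tree (verts H) (Ts' ! i)"
      using Ts' certificate_decomposition \<open>i < k\<close> by (auto simp: k_tree_decomposition_def)
    then have "finite (Ts' ! i)" "Suc (card (Ts ! i)) = Suc (card (Ts' ! i))"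
      by (simp_all only: card_spanning_tree[OF finite_verts])
    ultimately show ?case using card_subset_eq[of "Ts' ! i" "Ts ! i"] by simp
  qed
  then show "Ts' ! i = Ts ! i" if "i < length Ts'" for i
    using that Ts' by (simp add: k_tree_decomposition_def)
qed

end

theorem theorem1p7:
  fixes k :: nat
    and H :: "('v, 'e) multihypergraph"
    and F :: "'e \<Rightarrow> 'v set set"
    and Ts :: "('v, 'e) labelled_graph list"
    and l :: "'e \<Rightarrow> nat"
  assumes "1 \<le> k"
    and "labelled_multihypergraph H"
    and "layer_contained_certificate k H F Ts l"
  shows "critical k H \<and>
         weakly_partition_connected k H \<and>
         (k_tree_decomposition k (verts H) (assigned_graph H F) Ts \<and>
          (\<forall>Ts'. k_tree_decomposition k (verts H) (assigned_graph H F) Ts' \<and>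
                 same_signature H F Ts' Ts \<longrightarrow> Ts' = Ts)) \<and>
         k_distinguishable k H F"
  using certificate_critical[OF assms(2,3)]
    certificate_weakly_partition_connected[OF assms(2,3)]
    certificate_decomposition[OF assms(2,3)] certificate_unique[OF assms(2,3)]
  unfolding k_distinguishable_def by blast

end
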